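(* For every $\mathtt{ReDiP}$ program $P$ over variables $x_1,\dots,x_k$, the PGF transformer $[\![P]\!]$ is (i) a well-defined function from PGF to PGF; (ii) continuous, i.e., $[\![P]\!](\sup\Gamma)=\sup [\![P]\!](\Gamma)$ for every ascending chain $\Gamma$ of PGF; (iii) linear, i.e., $[\![P]\!]\big(\sum_{\sigma\in\mathbb{N}^k} g(\sigma)\vec X^\sigma\big)=\sum_{\sigma\in\mathbb{N}^k} g(\sigma)[\![P]\!](\vec X^\sigma)$ for every PGF $g$.
   Context: Formal power series (FPS): an FPS in $\vec X=(X_1,\dots,X_k)$ is a map $f:\mathbb{N}^k\to\mathbb{R}$, written $\sum_\sigma f(\sigma)\vec X^\sigma$; ring operations are coefficient-wise addition and Cauchy product. A PGF is an FPS with nonnegative coefficients summing to at most $1$. PGF are ordered pointwise ($g\sqsubseteq f$ iff $g(\sigma)\le f(\sigma)$ for all $\sigma$); this is an $\omega$-complete partial order with least element $0$. For an FPS viewed as $\sum_i f(i)X^i$ in one indeterminate $X$: $f[X/h]=\sum_i f(i)h^i$, $f[X/0]=f(0)$, $f[X/1]=\sum_i f(i)$, $\partial_X$ formal derivative. $\mathtt{ReDiP}$ syntax (variables range over $\mathbb{N}$, $X$ corresponds to variable $x$, $n\in\mathbb{N}$): $P ::= x := n \mid x{-}{-} \mid x \mathrel{+}= \mathrm{iid}(D, y) \mid \mathtt{if}(x<n)\{P_1\}\mathtt{else}\{P_2\} \mid P_1; P_2 \mid \mathtt{while}(x<n)\{P_1\}$, where $D$ is a distribution expression with PGF $[\![D]\!]\in\mathbb{R}[[T]]$.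 Semantics: $[\![x:=n]\!](g)=g[X/1]X^n$; $[\![x{-}{-}]\!](g)=(g-g[X/0])X^{-1}+g[X/0]$; $[\![x \mathrel{+}= \mathrm{iid}(D,y)]\!](g)=g[Y/Y[\![D]\!][T/X]]$; $[\![\mathtt{if}(x<n)\{P_1\}\mathtt{else}\{P_2\}]\!](g)=[\![P_1]\!](g_{x<n})+[\![P_2]\!](g-g_{x<n})$ with $g_{x<n}=\sum_{i=0}^{n-1}\frac1{i!}(\partial_X^ig)[X/0]X^i$; $[\![P_1;P_2]\!]=[\![P_2]\!]\circ[\![P_1]\!]$; $[\![\mathtt{while}(x<n)\{P_1\}]\!]$ is the least fixed point of $\Phi(\psi)=\lambda f.(f-f_{x<n})+\psi([\![P_1]\!](f_{x<n}))$ over maps PGF$\to$PGF ordered pointwise. *)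

theory Defs
  imports
    "HOL-Analysis.Infinite_Sum"
    "HOL-Computational_Algebra.Formal_Power_Series"
    "HOL-Library.FuncSet"
begin

section \<open>Formal power series in finitely many indeterminates\<close>

text \<open>The indeterminates are indexed by a finite type, so an exponent vector in \<open>\<nat>\<^sup>k\<close> is a function
  into the natural numbers, and sums, differences and the order on exponents are taken pointwise.\<close>

typedef 'v mfps = "UNIV :: (('v \<Rightarrow> nat) \<Rightarrow> real) set"
  morphisms coeff Mfps ..

lemma coeff_Mfps [simp]: "coeff (Mfps f) = f"
  by (simp add: Mfps_inverse)

lemma mfps_eqI: "(\<And>\<sigma>. coeff f \<sigma> = coeff g \<sigma>) \<Longrightarrow> f = g"
  by (simp add: coeff_inject[symmetric] fun_eq_iff)

lemma finite_exponents_le [simp]: "finite {\<alpha> :: 'v::finite \<Rightarrow> nat. \<alpha> \<le> \<sigma>}"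
proof -
  have "{\<alpha>. \<alpha> \<le> \<sigma>} = Pi\<^sub>E UNIV (\<lambda>x. {..\<sigma> x})"
    by (auto simp: le_fun_def PiE_def)
  then show ?thesis
    by (simp add: finite_PiE)
qed

definition monom :: "('v \<Rightarrow> nat) \<Rightarrow> 'v mfps" where
  "monom \<sigma> = Mfps (\<lambda>\<tau>. if \<tau> = \<sigma> then 1 else 0)"

instantiation mfps :: (type) order
begin

definition "f \<le> g \<longleftrightarrow> (\<forall>\<sigma>. coeff f \<sigma> \<le> coeff g \<sigma>)"
definition "f < g \<longleftrightarrow> f \<le> g \<and> \<not> g \<le> (f :: 'a mfps)"

instance
proof
  fix f g h :: "'a mfps"
  show "f \<le> g \<Longrightarrow> g \<le> f \<Longrightarrow> f = g"
    by (rule mfps_eqI) (auto simp: less_eq_mfps_def intro: order_antisym)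
qed (auto simp: less_eq_mfps_def less_mfps_def intro: order_trans)

end

instantiation mfps :: (type) real_vector
begin

definition "0 = Mfps (\<lambda>_. 0)"
definition "f + g = Mfps (\<lambda>\<sigma>. coeff f \<sigma> + coeff g \<sigma>)"
definition "f - g = Mfps (\<lambda>\<sigma>. coeff f \<sigma> - coeff g \<sigma>)"
definition "- f = Mfps (\<lambda>\<sigma>. - coeff f \<sigma>)"
definition "c *\<^sub>R f = Mfps (\<lambda>\<sigma>. c * coeff f \<sigma>)"

instance
  by standard
    (simp_all add: zero_mfps_def plus_mfps_def minus_mfps_def uminus_mfps_def scaleR_mfps_def
      algebra_simps coeff_inverse)

end

lemma coeff_zero [simp]: "coeff 0 \<sigma> = 0"
  by (simp add: zero_mfps_def)

instantiation mfps :: (finite) real_algebra_1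
begin

definition "1 = monom (\<lambda>_. 0)"
definition "f * g = Mfps (\<lambda>\<sigma>. \<Sum>\<alpha> | \<alpha> \<le> \<sigma>. coeff f \<alpha> * coeff g (\<sigma> - \<alpha>))"

instance
proof
  fix f g h :: "'a mfps" and c :: real
  show "f * g * h = f * (g * h)"
  proof (rule mfps_eqI)
    fix \<sigma> :: "'a \<Rightarrow> nat"
    have "coeff (f * g * h) \<sigma> = (\<Sum>(\<alpha>, \<beta>) \<in> (SIGMA \<alpha>:{\<alpha>. \<alpha> \<le> \<sigma>}. {\<beta>. \<beta> \<le> \<alpha>}).
        coeff f \<beta> * coeff g (\<alpha> - \<beta>) * coeff h (\<sigma> - \<alpha>))"
      by (simp add: times_mfps_def sum_distrib_right sum.Sigma)
    also have "\<dots> = (\<Sum>(\<beta>, \<gamma>) \<in> (SIGMA \<beta>:{\<beta>. \<beta> \<le> \<sigma>}. {\<gamma>. \<gamma> \<le> \<sigma> - \<beta>}).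
        coeff f \<beta> * (coeff g \<gamma> * coeff h (\<sigma> - \<beta> - \<gamma>)))"
      by (rule sum.reindex_bij_witness
            [where i = "\<lambda>(\<beta>, \<gamma>). (\<lambda>x. \<beta> x + \<gamma> x, \<beta>)" and j = "\<lambda>(\<alpha>, \<beta>). (\<beta>, \<alpha> - \<beta>)"])
        (auto simp: le_fun_def fun_eq_iff mult.assoc le_diff_conv2 add.commute
          intro: order_trans diff_le_mono add_leD1 intro!: diff_le_mono arg_cong2[where f = "(*)"] arg_cong[where f = "coeff h"])
    also have "\<dots> = coeff (f * (g * h)) \<sigma>"
      by (simp add: times_mfps_def sum_distrib_left sum.Sigma)
    finally show "coeff (f * g * h) \<sigma> = coeff (f * (g * h)) \<sigma>" .
  qed
  show "(f + g) * h = f * h + g * h" "f * (g + h) = f * g + f * h"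
    by (simp_all add: times_mfps_def plus_mfps_def sum.distrib algebra_simps)
  show "c *\<^sub>R f * g = c *\<^sub>R (f * g)" "f * c *\<^sub>R g = c *\<^sub>R (f * g)"
    by (simp_all add: times_mfps_def scaleR_mfps_def sum_distrib_left algebra_simps)
  show "1 * f = f"
  proof (rule mfps_eqI)
    fix \<sigma> :: "'a \<Rightarrow> nat"
    have "coeff (1 * f) \<sigma> = (\<Sum>\<alpha> | \<alpha> \<le> \<sigma>. if \<alpha> = (\<lambda>_. 0) then coeff f \<sigma> else 0)"
      unfolding times_mfps_def one_mfps_def monom_def coeff_Mfps
      by (intro sum.cong refl) (simp add: fun_diff_def)
    moreover have "(\<lambda>_. 0) \<le> \<sigma>"
      by (simp add: le_fun_def)
    ultimately show "coeff (1 * f) \<sigma> = coeff f \<sigma>"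
      by simp
  qed
  show "f * 1 = f"
  proof (rule mfps_eqI)
    fix \<sigma> :: "'a \<Rightarrow> nat"
    have "\<sigma> - \<alpha> = (\<lambda>_. 0) \<longleftrightarrow> \<alpha> = \<sigma>" if "\<alpha> \<le> \<sigma>" for \<alpha>
      using that by (auto simp: le_fun_def fun_eq_iff intro: order_antisym)
    then have "coeff (f * 1) \<sigma> = (\<Sum>\<alpha> | \<alpha> \<le> \<sigma>. if \<alpha> = \<sigma> then coeff f \<sigma> else 0)"
      unfolding times_mfps_def one_mfps_def monom_def coeff_Mfps
      by (intro sum.cong refl) (simp del: fun_diff_def minus_apply)
    then show "coeff (f * 1) \<sigma> = coeff f \<sigma>"
      by simp
  qed
  have "coeff (0 :: 'a mfps) (\<lambda>_. 0) \<noteq> coeff 1 (\<lambda>_. 0)"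
    by (simp add: zero_mfps_def one_mfps_def monom_def)
  then show "(0 :: 'a mfps) \<noteq> 1"
    by metis
qed

end

instance mfps :: (finite) comm_ring_1
proof
  fix f g :: "'a mfps"
  show "f * g = g * f"
  proof (rule mfps_eqI)
    fix \<sigma> :: "'a \<Rightarrow> nat"
    show "coeff (f * g) \<sigma> = coeff (g * f) \<sigma>"
      unfolding times_mfps_def coeff_Mfps
      by (rule sum.reindex_bij_witness[where i = "\<lambda>\<alpha>. \<sigma> - \<alpha>" and j = "\<lambda>\<alpha>. \<sigma> - \<alpha>"])
        (auto simp: le_fun_def fun_eq_iff mult.commute intro!: arg_cong2[where f = "(*)"] arg_cong[where f = "coeff _"])
  qed
qed (simp_all add: algebra_simps)


subsection \<open>Infinite sums, substitution and derivatives\<close>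

text \<open>Infinite sums of series are formed coefficient by coefficient. As \<^const>\<open>infsum\<close> returns \<open>0\<close>
  where there is no convergence, summability is tracked separately.\<close>

definition mfps_summable :: "('i \<Rightarrow> 'v mfps) \<Rightarrow> bool" where
  "mfps_summable F \<longleftrightarrow> (\<forall>\<sigma>. (\<lambda>i. coeff (F i) \<sigma>) summable_on UNIV)"

definition mfps_infsum :: "('i \<Rightarrow> 'v mfps) \<Rightarrow> 'v mfps" where
  "mfps_infsum F = Mfps (\<lambda>\<sigma>. \<Sum>\<^sub>\<infinity>i. coeff (F i) \<sigma>)"

definition var :: "'v \<Rightarrow> 'v mfps" where
  "var x = monom ((\<lambda>_. 0)(x := 1))"

text \<open>The coefficient \<open>f(i)\<close> of \<open>X\<^sup>i\<close> in \<open>f\<close>, where \<open>f\<close> is viewed as a series in \<open>X\<close> alone whose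
  coefficients are series in the other indeterminates.\<close>

definition coeff_in :: "'v \<Rightarrow> 'v mfps \<Rightarrow> nat \<Rightarrow> 'v mfps" where
  "coeff_in x f i = Mfps (\<lambda>\<sigma>. if \<sigma> x = 0 then coeff f (\<sigma>(x := i)) else 0)"

text \<open>\<open>subst x h f\<close> is \<open>f[X/h]\<close>. For \<open>h = 0\<close> it always exists and equals \<open>f(0)\<close>, because \<open>0\<^sup>0 = 1\<close>.\<close>

definition subst_summable :: "'v::finite \<Rightarrow> 'v mfps \<Rightarrow> 'v mfps \<Rightarrow> bool" where
  "subst_summable x h f \<longleftrightarrow> mfps_summable (\<lambda>i. coeff_in x f i * h ^ i)"

definition subst :: "'v::finite \<Rightarrow> 'v mfps \<Rightarrow> 'v mfps \<Rightarrow> 'v mfps" where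
  "subst x h f = mfps_infsum (\<lambda>i. coeff_in x f i * h ^ i)"

lemma subst_summable_0: "subst_summable x 0 f"
proof -
  have "(\<lambda>i. coeff (coeff_in x f i * 0 ^ i) \<sigma>) summable_on UNIV" for \<sigma>
    by (rule summable_on_cong_neutral[where S = "{0}", THEN iffD1])
      (auto simp: power_0_left)
  then show ?thesis
    by (simp add: subst_summable_def mfps_summable_def)
qed

lemma subst_0: "subst x 0 f = coeff_in x f 0"
proof (rule mfps_eqI)
  fix \<sigma>
  have "(\<Sum>\<^sub>\<infinity>i. coeff (coeff_in x f i * 0 ^ i) \<sigma>) = (\<Sum>\<^sub>\<infinity>i\<in>{0}. coeff (coeff_in x f i * 0 ^ i) \<sigma>)"
    by (rule infsum_cong_neutral) (auto simp: power_0_left)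
  then show "coeff (subst x 0 f) \<sigma> = coeff (coeff_in x f 0) \<sigma>"
    by (simp add: subst_def mfps_infsum_def)
qed

text \<open>Substitution \<open>D[T/h]\<close> into a series \<open>D\<close> in the single indeterminate \<open>T\<close>.\<close>

definition fps_subst_summable :: "real fps \<Rightarrow> 'v::finite mfps \<Rightarrow> bool" where
  "fps_subst_summable D h \<longleftrightarrow> mfps_summable (\<lambda>i. fps_nth D i *\<^sub>R h ^ i)"

definition fps_subst :: "real fps \<Rightarrow> 'v::finite mfps \<Rightarrow> 'v mfps" where
  "fps_subst D h = mfps_infsum (\<lambda>i. fps_nth D i *\<^sub>R h ^ i)"

text \<open>\<open>div_var x f\<close> is \<open>f X\<^sup>-\<^sup>1\<close>. It is only meaningful if \<open>f[X/0] = 0\<close>.\<close>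

definition div_var :: "'v \<Rightarrow> 'v mfps \<Rightarrow> 'v mfps" where
  "div_var x f = Mfps (\<lambda>\<sigma>. coeff f (\<sigma>(x := Suc (\<sigma> x))))"

lemma div_var_mult_var:
  assumes "subst x 0 f = 0"
  shows "div_var x f * var x = f"
proof (rule mfps_eqI)
  fix \<sigma> :: "'a \<Rightarrow> nat"
  let ?e = "(\<lambda>_. 0)(x := 1) :: 'a \<Rightarrow> nat"
  have eq: "coeff (div_var x f * var x) \<sigma> = (\<Sum>\<alpha> | \<alpha> \<le> \<sigma>.
      if \<sigma> - \<alpha> = ?e then coeff f (\<alpha>(x := Suc (\<alpha> x))) else 0)"
    by (auto simp: times_mfps_def div_var_def var_def monom_def intro!: sum.cong)
  show "coeff (div_var x f * var x) \<sigma> = coeff f \<sigma>"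
  proof (cases "\<sigma> x = 0")
    case True
    then have "\<sigma>(x := 0) = \<sigma>"
      by auto
    then have "coeff f \<sigma> = coeff (coeff_in x f 0) \<sigma>"
      using True by (simp add: coeff_in_def)
    moreover have "\<sigma> - \<alpha> \<noteq> ?e" for \<alpha>
      using True by (auto simp: fun_eq_iff intro!: exI[of _ x])
    ultimately show ?thesis
      using assms unfolding eq subst_0 by (simp add: zero_mfps_def)
  next
    case False
    let ?a = "\<sigma>(x := \<sigma> x - 1)"
    have *: "(\<sigma> - \<alpha> = ?e) = (\<alpha> = ?a)" if "\<alpha> \<le> \<sigma>" for \<alpha>
    proof
      assume "\<sigma> - \<alpha> = ?e"
      then have "\<sigma> y - \<alpha> y = ?e y" for y
        by (metis minus_apply)
      moreover have "\<alpha> y \<le> \<sigma> y" for y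
        using that by (simp add: le_fun_def)
      ultimately show "\<alpha> = ?a"
        by (intro ext) (metis diff_diff_cancel diff_zero fun_upd_apply)
    next
      assume "\<alpha> = ?a"
      then show "\<sigma> - \<alpha> = ?e"
        using False by (auto simp: fun_eq_iff)
    qed
    have "coeff (div_var x f * var x) \<sigma> =
        (\<Sum>\<alpha> | \<alpha> \<le> \<sigma>. if \<alpha> = ?a then coeff f \<sigma> else 0)"
      unfolding eq using False by (intro sum.cong refl) (simp only: mem_Collect_eq * cong: if_cong, simp)
    also have "\<dots> = coeff f \<sigma>"
    proof -
      have "?a \<le> \<sigma>"
        by (simp add: le_fun_def)
      then show ?thesis
        by simp
    qed
    finally show ?thesis .
  qed
qed

definition deriv_var :: "'v \<Rightarrow> 'v mfps \<Rightarrow> 'v mfps" where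
  "deriv_var x f = Mfps (\<lambda>\<sigma>. real (Suc (\<sigma> x)) * coeff f (\<sigma>(x := Suc (\<sigma> x))))"

text \<open>\<open>less_part x n g\<close> is \<open>g\<^bsub>x<n\<^esub>\<close>.\<close>

definition less_part :: "'v::finite \<Rightarrow> nat \<Rightarrow> 'v mfps \<Rightarrow> 'v mfps" where
  "less_part x n g =
     (\<Sum>i<n. (1 / fact i) *\<^sub>R (subst x 0 ((deriv_var x ^^ i) g) * var x ^ i))"


section \<open>Probability generating functions\<close>

definition PGF :: "'v mfps set" where
  "PGF = {f. (\<forall>\<sigma>. 0 \<le> coeff f \<sigma>) \<and> coeff f summable_on UNIV \<and> (\<Sum>\<^sub>\<infinity>\<sigma>. coeff f \<sigma>) \<le> 1}"

definition PGF1 :: "real fps set" where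
  "PGF1 = {D. (\<forall>i. 0 \<le> fps_nth D i) \<and> fps_nth D summable_on UNIV \<and> (\<Sum>\<^sub>\<infinity>i. fps_nth D i) \<le> 1}"

definition is_sup_PGF :: "'v mfps set \<Rightarrow> 'v mfps \<Rightarrow> bool" where
  "is_sup_PGF A s \<longleftrightarrow>
     s \<in> PGF \<and> (\<forall>f\<in>A. f \<le> s) \<and> (\<forall>u\<in>PGF. (\<forall>f\<in>A. f \<le> u) \<longrightarrow> s \<le> u)"

text \<open>Least fixed points over the maps from PGF to PGF, ordered pointwise. Such maps are represented
  by extensional functions, so that a least fixed point is unique. The operator itself need not
  preserve this set of maps.\<close>

definition is_least_fixpoint ::
    "(('v mfps \<Rightarrow> 'v mfps) \<Rightarrow> ('v mfps \<Rightarrow> 'v mfps)) \<Rightarrow> ('v mfps \<Rightarrow> 'v mfps) \<Rightarrow> bool" where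
  "is_least_fixpoint \<Phi> \<psi> \<longleftrightarrow>
     \<psi> \<in> PGF \<rightarrow>\<^sub>E PGF \<and> (\<forall>f\<in>PGF. \<Phi> \<psi> f = \<psi> f) \<and>
     (\<forall>\<chi> \<in> PGF \<rightarrow>\<^sub>E PGF. (\<forall>f\<in>PGF. \<Phi> \<chi> f = \<chi> f) \<longrightarrow> (\<forall>f\<in>PGF. \<psi> f \<le> \<chi> f))"


section \<open>ReDiP programs\<close>

text \<open>Distribution expressions are left abstract: they are the elements of \<open>'d\<close>, and their meaning is
  given by a function into the univariate series.\<close>

datatype ('v, 'd) redip =
    Assign 'v nat
  | Decr 'v
  | AddIid 'v 'd 'v
  | IfLess 'v nat "('v, 'd) redip" "('v, 'd) redip"
  | Seq "('v, 'd) redip" "('v, 'd) redip"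
  | WhileLess 'v nat "('v, 'd) redip"

definition while_op ::
    "'v::finite \<Rightarrow> nat \<Rightarrow> ('v mfps \<Rightarrow> 'v mfps) \<Rightarrow> ('v mfps \<Rightarrow> 'v mfps) \<Rightarrow> ('v mfps \<Rightarrow> 'v mfps)" where
  "while_op x n body \<psi> = (\<lambda>f. (f - less_part x n f) + \<psi> (body (less_part x n f)))"

primrec sem :: "('d \<Rightarrow> real fps) \<Rightarrow> ('v::finite, 'd) redip \<Rightarrow> 'v mfps \<Rightarrow> 'v mfps" where
  "sem \<D> (Assign x n) = (\<lambda>g. subst x 1 g * var x ^ n)"
| "sem \<D> (Decr x) = (\<lambda>g. div_var x (g - subst x 0 g) + subst x 0 g)"
| "sem \<D> (AddIid x D y) = (\<lambda>g. subst y (var y * fps_subst (\<D> D) (var x)) g)"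
| "sem \<D> (IfLess x n P\<^sub>1 P\<^sub>2) =
     (\<lambda>g. sem \<D> P\<^sub>1 (less_part x n g) + sem \<D> P\<^sub>2 (g - less_part x n g))"
| "sem \<D> (Seq P\<^sub>1 P\<^sub>2) = sem \<D> P\<^sub>2 \<circ> sem \<D> P\<^sub>1"
| "sem \<D> (WhileLess x n P\<^sub>1) = (THE \<psi>. is_least_fixpoint (while_op x n (sem \<D> P\<^sub>1)) \<psi>)"

text \<open>\<open>sem\<close> is a total function, with arbitrary values where an infinite sum diverges or a least fixed
  point is missing. \<open>sem_defined \<D> P g\<close> states that this does not happen when \<open>P\<close> is evaluated at
  \<open>g\<close>: all infinite sums involved converge and all least fixed points involved exist.\<close>

primrec sem_defined :: "('d \<Rightarrow> real fps) \<Rightarrow> ('v::finite, 'd) redip \<Rightarrow> 'v mfps \<Rightarrow> bool" where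
  "sem_defined \<D> (Assign x n) = (\<lambda>g. subst_summable x 1 g)"
| "sem_defined \<D> (Decr x) = (\<lambda>g. subst_summable x 0 g)"
| "sem_defined \<D> (AddIid x D y) =
     (\<lambda>g. fps_subst_summable (\<D> D) (var x) \<and>
          subst_summable y (var y * fps_subst (\<D> D) (var x)) g)"
| "sem_defined \<D> (IfLess x n P\<^sub>1 P\<^sub>2) =
     (\<lambda>g. sem_defined \<D> P\<^sub>1 (less_part x n g) \<and> sem_defined \<D> P\<^sub>2 (g - less_part x n g))"
| "sem_defined \<D> (Seq P\<^sub>1 P\<^sub>2) =
     (\<lambda>g. sem_defined \<D> P\<^sub>1 g \<and> sem_defined \<D> P\<^sub>2 (sem \<D> P\<^sub>1 g))"
| "sem_defined \<D> (WhileLess x n P\<^sub>1) =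
     (\<lambda>g. (\<forall>f\<in>PGF. sem_defined \<D> P\<^sub>1 (less_part x n f)) \<and>
          (\<exists>!\<psi>. is_least_fixpoint (while_op x n (sem \<D> P\<^sub>1)) \<psi>))"

end

theory Submission
  imports Defs "HOL-Analysis.Elementary_Metric_Spaces"
begin

text \<open>A PGF is a sub-probability distribution on states, and every program acts on it as a Markov
  kernel: \<open>\<lbrakk>P\<rbrakk>(g) = (\<Sum>\<sigma>. g(\<sigma>) K(\<sigma>))\<close> for a family \<open>K\<close> of PGFs. Transformers of this form are linear,
  map PGFs to PGFs by Tonelli, and are continuous by Fatou's lemma. They are closed under
  composition (Tonelli again) and conditionals. For a loop, the Kleene iterates of the
  characteristic operator are kernels increasing to a kernel, and Fatou's lemma shows that the limit
  is the least fixed point.\<close>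

section \<open>Nonnegative sums\<close>

text \<open>Nonnegativity turns summable rows with a summable family of row sums into summability
  over the product, where the two indices may be swapped.\<close>

lemma has_sum_tonelli:
  fixes f :: "'i \<Rightarrow> 'j \<Rightarrow> real"
  assumes nonneg: "\<And>i j. 0 \<le> f i j"
    and rows: "\<And>i. (f i has_sum g i) UNIV"
    and total: "(g has_sum S) UNIV"
  shows "((\<lambda>j. \<Sum>\<^sub>\<infinity>i. f i j) has_sum S) UNIV"
proof -
  have "(\<lambda>(i, j). f i j) summable_on UNIV \<times> UNIV"
    using rows total nonneg
    by (intro summable_on_SigmaI[where g = g]) (auto simp: has_sum_imp_summable)
  then have "((\<lambda>(i, j). f i j) has_sum S) (UNIV \<times> UNIV)"
    using rows total by (intro has_sum_SigmaI[where g = g]) auto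
  then have swapped: "((\<lambda>(j, i). f i j) has_sum S) (UNIV \<times> UNIV)"
    by (subst (asm) has_sum_swap) simp
  \<comment> \<open>Without convergence of each column the \<open>infsum\<close> in the goal would
    be the default value 0. Column j converges because its entries are dominated by the row
    sums.\<close>
  have "(\<lambda>i. f i j) summable_on UNIV" for j
  proof (rule summable_on_comparison_test[OF has_sum_imp_summable[OF total]])
    fix i
    have "sum (f i) {j} \<le> g i"
      using nonneg by (intro finite_sum_le_has_sum[OF rows]) auto
    then show "f i j \<le> g i"
      by simp
  qed (rule nonneg)
  with swapped show ?thesis
    by (intro has_sum_SigmaD[OF swapped]) auto
qed

text \<open>Fatou's lemma for the counting measure: a finite partial sum commutes with the limit and
  so inherits the bound B, and a nonnegative sum is controlled by its finite partial sums.\<close>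

lemma infsum_limit_le:
  fixes f :: "nat \<Rightarrow> 'i \<Rightarrow> real"
  assumes nonneg: "\<And>n i. 0 \<le> f n i"
    and summable: "\<And>n. f n summable_on UNIV"
    and le: "\<And>n. (\<Sum>\<^sub>\<infinity>i. f n i) \<le> B"
    and lim: "\<And>i. (\<lambda>n. f n i) \<longlonglongrightarrow> h i"
  shows "h summable_on UNIV" "(\<Sum>\<^sub>\<infinity>i. h i) \<le> B"
proof -
  have h_nonneg: "0 \<le> h i" for i
    by (rule LIMSEQ_le_const[OF lim]) (use nonneg in auto)
  have sum_le: "sum h F \<le> B" if "finite F" for F
  proof (rule LIMSEQ_le_const2)
    show "(\<lambda>n. sum (f n) F) \<longlonglongrightarrow> sum h F"
      by (intro tendsto_sum lim)
    show "\<exists>N. \<forall>n\<ge>N. sum (f n) F \<le> B"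
      using finite_sum_le_infsum[OF summable that] nonneg le by (meson order_trans subset_UNIV)
  qed
  show sm: "h summable_on UNIV"
    using sum_le h_nonneg by (intro nonneg_bdd_above_summable_on bdd_aboveI[where M = B]) auto
  show "(\<Sum>\<^sub>\<infinity>i. h i) \<le> B"
    using sum_le by (intro infsum_le_finite_sums[OF sm])
qed

section \<open>Mixtures\<close>

text \<open>The index type is arbitrary so that one theory of mixtures serves weights on exponent
  vectors (\<open>PGF\<close>) as well as weights on numbers (\<open>PGF1\<close>).\<close>

definition subprob :: "('i \<Rightarrow> real) \<Rightarrow> bool" where
  "subprob w \<longleftrightarrow> (\<forall>i. 0 \<le> w i) \<and> w summable_on UNIV \<and> (\<Sum>\<^sub>\<infinity>i. w i) \<le> 1"

lemma PGF_iff_subprob: "f \<in> PGF \<longleftrightarrow> subprob (coeff f)"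
  by (simp add: PGF_def subprob_def)

lemma PGF1_iff_subprob: "D \<in> PGF1 \<longleftrightarrow> subprob (fps_nth D)"
  by (simp add: PGF1_def subprob_def)

lemma subprob_le_1:
  assumes "subprob w"
  shows "w i \<le> 1"
proof -
  have "sum w {i} \<le> (\<Sum>\<^sub>\<infinity>i. w i)"
    using assms by (intro finite_sum_le_infsum) (auto simp: subprob_def)
  with assms show ?thesis
    by (simp add: subprob_def)
qed

lemma coeff_nonneg: "f \<in> PGF \<Longrightarrow> 0 \<le> coeff f \<sigma>"
  by (simp add: PGF_def)

lemma subprob_dominated:
  assumes w: "subprob w" and v: "\<And>i. 0 \<le> v i" "\<And>i. v i \<le> w i"
  shows "subprob v"
proof -
  have w': "w summable_on UNIV" "(\<Sum>\<^sub>\<infinity>i. w i) \<le> 1"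
    using w by (simp_all add: subprob_def)
  have sm: "v summable_on UNIV"
    by (rule summable_on_comparison_test[OF w'(1) v(2) v(1)])
  have "(\<Sum>\<^sub>\<infinity>i. v i) \<le> (\<Sum>\<^sub>\<infinity>i. w i)"
    by (rule infsum_mono[OF sm w'(1) v(2)])
  with w' sm v(1) show ?thesis
    by (simp add: subprob_def)
qed

lemma PGF_dominated:
  assumes "g \<in> PGF" "\<And>\<sigma>. 0 \<le> coeff f \<sigma>" "f \<le> g"
  shows "f \<in> PGF"
  using assms unfolding PGF_iff_subprob less_eq_mfps_def
  by (auto intro: subprob_dominated)

lemma coeff_add: "coeff (f + g) \<sigma> = coeff f \<sigma> + coeff g \<sigma>"
  and coeff_diff: "coeff (f - g) \<sigma> = coeff f \<sigma> - coeff g \<sigma>"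
  and coeff_scaleR: "coeff (c *\<^sub>R f) \<sigma> = c * coeff f \<sigma>"
  and coeff_times: "coeff (f' * g') \<tau> = (\<Sum>\<alpha> | \<alpha> \<le> \<tau>. coeff f' \<alpha> * coeff g' (\<tau> - \<alpha>))"
  and coeff_monom: "coeff (monom \<sigma>) \<rho> = (if \<rho> = \<sigma> then 1 else 0)"
  by (simp_all add: plus_mfps_def minus_mfps_def scaleR_mfps_def times_mfps_def monom_def)

text \<open>The law obtained by drawing i with weight w i and then a state from K i. With w =
  \<open>coeff g\<close> it is the right-hand side of linearity; with K i = h ^ i it is substitution
  into a univariate series.\<close>

definition mix :: "('i \<Rightarrow> real) \<Rightarrow> ('i \<Rightarrow> 'v mfps) \<Rightarrow> 'v mfps" where
  "mix w K = mfps_infsum (\<lambda>i. w i *\<^sub>R K i)"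

lemma coeff_mix: "coeff (mix w K) \<tau> = (\<Sum>\<^sub>\<infinity>i. w i * coeff (K i) \<tau>)"
  by (simp add: mix_def mfps_infsum_def coeff_scaleR)

context
  fixes w :: "'i \<Rightarrow> real" and K :: "'i \<Rightarrow> 'v mfps"
  assumes w: "subprob w" and K: "\<And>i. K i \<in> PGF"
begin

lemma mix_nonneg: "0 \<le> w i * coeff (K i) \<tau>"
  using w K by (simp add: subprob_def coeff_nonneg)

lemma mix_summable: "(\<lambda>i. w i * coeff (K i) \<tau>) summable_on UNIV"
proof (rule summable_on_comparison_test[of w])
  show "w summable_on UNIV"
    using w by (simp add: subprob_def)
  show "w i * coeff (K i) \<tau> \<le> w i" for i
    using w K[of i] by (intro mult_left_le) (auto simp: subprob_def PGF_iff_subprob subprob_le_1)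
qed (rule mix_nonneg)

lemma has_sum_mix: "((\<lambda>i. w i * coeff (K i) \<tau>) has_sum coeff (mix w K) \<tau>) UNIV"
  unfolding coeff_mix by (intro has_sum_infsum mix_summable)

lemma mfps_summable_mix: "mfps_summable (\<lambda>i. w i *\<^sub>R K i)"
  by (simp add: mfps_summable_def coeff_scaleR mix_summable)

lemma mix_in_PGF: "mix w K \<in> PGF"
proof -
  \<comment> \<open>The mass of each component: by Tonelli the mixture has mass equal to the sum of
    the w i * m i, which is at most the sum of the w i.\<close>
  define m where "m i = (\<Sum>\<^sub>\<infinity>\<tau>. coeff (K i) \<tau>)" for i
  have m: "0 \<le> m i" "m i \<le> 1" "(coeff (K i) has_sum m i) UNIV" for i
    using K[of i] by (auto simp: m_def PGF_def intro!: infsum_nonneg has_sum_infsum)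
  have v: "subprob (\<lambda>i. w i * m i)"
    using w m by (intro subprob_dominated[OF w]) (auto simp: subprob_def intro: mult_left_le)
  have "((\<lambda>\<tau>. coeff (mix w K) \<tau>) has_sum (\<Sum>\<^sub>\<infinity>i. w i * m i)) UNIV"
    unfolding coeff_mix using v m(3)
    by (intro has_sum_tonelli[where g = "\<lambda>i. w i * m i"] mix_nonneg has_sum_cmult_right)
      (auto simp: subprob_def intro: has_sum_infsum)
  moreover have "0 \<le> coeff (mix w K) \<tau>" for \<tau>
    unfolding coeff_mix by (intro infsum_nonneg mix_nonneg)
  ultimately show ?thesis
    using v by (auto simp: PGF_def subprob_def infsumI has_sum_imp_summable)
qed

text \<open>Associativity of kernel composition: both sides are the same nonnegative double sum over
  i and \<sigma>, evaluated in different orders.\<close>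

lemma mix_mix:
  assumes L: "\<And>\<sigma>. L \<sigma> \<in> PGF"
  shows "mix (coeff (mix w K)) L = mix w (\<lambda>i. mix (coeff (K i)) L)"
proof (rule mfps_eqI)
  fix \<tau>
  have "((\<lambda>\<sigma>. \<Sum>\<^sub>\<infinity>i. w i * (coeff (K i) \<sigma> * coeff (L \<sigma>) \<tau>)) has_sum
      coeff (mix w (\<lambda>i. mix (coeff (K i)) L)) \<tau>) UNIV"
  proof (rule has_sum_tonelli)
    show "0 \<le> w i * (coeff (K i) \<sigma> * coeff (L \<sigma>) \<tau>)" for i \<sigma>
      using w K L by (simp add: subprob_def coeff_nonneg)
    show "((\<lambda>\<sigma>. w i * (coeff (K i) \<sigma> * coeff (L \<sigma>) \<tau>)) has_sum
        w i * coeff (mix (coeff (K i)) L) \<tau>) UNIV" for i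
      \<comment> \<open>The qualified names give the facts for arbitrary weights and families; here
        the weights are \<open>coeff (K i)\<close> and the family is L.\<close>
      using K L by (intro has_sum_cmult_right Submission.has_sum_mix) (auto simp: PGF_iff_subprob)
    show "((\<lambda>i. w i * coeff (mix (coeff (K i)) L) \<tau>) has_sum
        coeff (mix w (\<lambda>i. mix (coeff (K i)) L)) \<tau>) UNIV"
      using w K L by (intro Submission.has_sum_mix Submission.mix_in_PGF)
        (auto simp: PGF_iff_subprob)
  qed
  moreover have "(\<Sum>\<^sub>\<infinity>i. w i * (coeff (K i) \<sigma> * coeff (L \<sigma>) \<tau>)) =
      coeff (mix w K) \<sigma> * coeff (L \<sigma>) \<tau>" for \<sigma>
    using infsum_cmult_left'[of "\<lambda>i. w i * coeff (K i) \<sigma>" "coeff (L \<sigma>) \<tau>" UNIV]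
    by (simp add: coeff_mix mult.assoc)
  ultimately show "coeff (mix (coeff (mix w K)) L) \<tau> = coeff (mix w (\<lambda>i. mix (coeff (K i)) L)) \<tau>"
    by (simp add: coeff_mix[of "coeff (mix w K)"] infsumI)
qed

end

section \<open>Point masses, monotonicity and limits of mixtures\<close>

lemma infsum_delta:
  fixes c :: "'a \<Rightarrow> real"
  shows "(\<Sum>\<^sub>\<infinity>i. if i = a then c i else 0) = c a"
    "(\<lambda>i. if i = a then c i else 0) summable_on UNIV"
proof -
  have "((\<lambda>i. if i = a then c i else 0) has_sum c a) UNIV"
    by (rule has_sum_finite_neutralI[of "{a}"]) auto
  then show "(\<Sum>\<^sub>\<infinity>i. if i = a then c i else 0) = c a"
    "(\<lambda>i. if i = a then c i else 0) summable_on UNIV"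
    by (auto simp: infsumI has_sum_imp_summable)
qed

lemma monom_in_PGF: "monom \<sigma> \<in> PGF"
proof -
  have "coeff (monom \<sigma>) = (\<lambda>\<rho>. if \<rho> = \<sigma> then 1 else 0)"
    by (simp add: fun_eq_iff coeff_monom)
  then show ?thesis
    using infsum_delta[of \<sigma> "\<lambda>_. 1"] by (simp add: PGF_def)
qed

lemma zero_in_PGF: "0 \<in> PGF"
  by (rule PGF_dominated[OF monom_in_PGF]) (auto simp: less_eq_mfps_def coeff_monom)

lemma mix_monom: "mix w monom = Mfps w"
proof (rule mfps_eqI)
  fix \<tau>
  have "coeff (mix w monom) \<tau> = (\<Sum>\<^sub>\<infinity>\<sigma>. if \<sigma> = \<tau> then w \<sigma> else 0)"
    unfolding coeff_mix coeff_monom by (intro infsum_cong) auto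
  then show "coeff (mix w monom) \<tau> = coeff (Mfps w) \<tau>"
    by (simp add: infsum_delta)
qed

lemma mix_coeff_monom [simp]: "mix (coeff g) monom = g"
  by (simp add: mix_monom coeff_inverse)

text \<open>Together with \<open>mix_coeff_monom\<close> this gives the unit laws:
  \<open>monom\<close> is the identity kernel, and a kernel is recovered by evaluating at point
  masses.\<close>

lemma mix_monom_left: "mix (coeff (monom \<sigma>)) K = K \<sigma>"
proof (rule mfps_eqI)
  fix \<tau>
  have "coeff (mix (coeff (monom \<sigma>)) K) \<tau> = (\<Sum>\<^sub>\<infinity>\<rho>. if \<rho> = \<sigma> then coeff (K \<rho>) \<tau> else 0)"
    unfolding coeff_mix coeff_monom by (intro infsum_cong) auto
  then show "coeff (mix (coeff (monom \<sigma>)) K) \<tau> = coeff (K \<sigma>) \<tau>"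
    by (simp add: infsum_delta)
qed

lemma mix_mono:
  assumes "subprob v" "subprob w" "\<And>i. v i \<le> w i" "\<And>i. K i \<in> PGF" "\<And>i. L i \<in> PGF" "\<And>i. K i \<le> L i"
  shows "mix v K \<le> mix w L"
  unfolding less_eq_mfps_def coeff_mix
proof (intro allI infsum_mono mix_summable)
  show "v i * coeff (K i) \<tau> \<le> w i * coeff (L i) \<tau>" for i \<tau>
    using assms by (intro mult_mono) (auto simp: less_eq_mfps_def coeff_nonneg subprob_def)
qed (use assms in auto)

text \<open>Fatou applied to each coefficient. Weights and components may both vary with n:
  continuity varies the weights along a chain, loops vary the components along the Kleene
  iterates.\<close>

lemma mix_limit_le:
  assumes "\<And>n. subprob (v n)" "\<And>n i. K n i \<in> PGF"
    and "\<And>i. (\<lambda>n. v n i) \<longlonglongrightarrow> w i"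
    and "\<And>i \<tau>. (\<lambda>n. coeff (K n i) \<tau>) \<longlonglongrightarrow> coeff (L i) \<tau>"
    and le: "\<And>n. mix (v n) (K n) \<le> u"
  shows "mix w L \<le> u"
  unfolding less_eq_mfps_def coeff_mix
proof
  fix \<tau>
  show "(\<Sum>\<^sub>\<infinity>i. w i * coeff (L i) \<tau>) \<le> coeff u \<tau>"
  proof (rule infsum_limit_le)
    show "(\<Sum>\<^sub>\<infinity>i. v n i * coeff (K n i) \<tau>) \<le> coeff u \<tau>" for n
      using le[of n] by (simp add: less_eq_mfps_def coeff_mix)
    show "(\<lambda>n. v n i * coeff (K n i) \<tau>) \<longlonglongrightarrow> w i * coeff (L i) \<tau>" for i
      using assms by (intro tendsto_mult)
  qed (use assms in \<open>auto simp: mix_nonneg mix_summable\<close>)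
qed

section \<open>Ascending chains\<close>

text \<open>Each coefficient is increasing and bounded by 1, hence converges, and Fatou keeps the
  total mass of the limit at most 1. The convergence is exported with the supremum because
  \<open>mix_limit_le\<close> needs it.\<close>

lemma incseq_PGF_limit:
  assumes PGF: "\<And>n. \<Gamma> n \<in> PGF" and inc: "incseq \<Gamma>"
  obtains s where "is_sup_PGF (range \<Gamma>) s" "\<And>\<sigma>. (\<lambda>n. coeff (\<Gamma> n) \<sigma>) \<longlonglongrightarrow> coeff s \<sigma>"
proof -
  have inc': "incseq (\<lambda>n. coeff (\<Gamma> n) \<sigma>)" for \<sigma>
    using inc by (auto simp: incseq_def less_eq_mfps_def)
  have "\<exists>l. (\<lambda>n. coeff (\<Gamma> n) \<sigma>) \<longlonglongrightarrow> l" for \<sigma>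
    using PGF incseq_convergent[OF inc'[of \<sigma>], of 1]
    by (metis PGF_iff_subprob subprob_le_1)
  then obtain l where l: "\<And>\<sigma>. (\<lambda>n. coeff (\<Gamma> n) \<sigma>) \<longlonglongrightarrow> l \<sigma>"
    by metis
  define s where "s = Mfps l"
  have lim: "(\<lambda>n. coeff (\<Gamma> n) \<sigma>) \<longlonglongrightarrow> coeff s \<sigma>" for \<sigma>
    using l by (simp add: s_def)
  have "s \<in> PGF"
    unfolding PGF_def mem_Collect_eq
  proof (intro conjI allI)
    show "0 \<le> coeff s \<sigma>" for \<sigma>
      using PGF by (intro LIMSEQ_le_const[OF lim]) (auto simp: coeff_nonneg)
    have \<Gamma>: "0 \<le> coeff (\<Gamma> n) \<sigma>" "coeff (\<Gamma> n) summable_on UNIV" "(\<Sum>\<^sub>\<infinity>\<sigma>. coeff (\<Gamma> n) \<sigma>) \<le> 1" for n \<sigma>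
      using PGF[of n] by (simp_all add: PGF_def)
    show "coeff s summable_on UNIV" "(\<Sum>\<^sub>\<infinity>\<sigma>. coeff s \<sigma>) \<le> 1"
      by (rule infsum_limit_le[where f = "\<lambda>n. coeff (\<Gamma> n)", OF \<Gamma> lim])+
  qed
  moreover have "\<Gamma> n \<le> s" for n
    unfolding less_eq_mfps_def using incseq_le[OF inc' lim] by blast
  moreover have "s \<le> u" if "\<And>n. \<Gamma> n \<le> u" for u
    unfolding less_eq_mfps_def using that
    by (intro allI LIMSEQ_le_const2[OF lim]) (auto simp: less_eq_mfps_def)
  ultimately show ?thesis
    using that[OF _ lim] by (auto simp: is_sup_PGF_def)
qed

section \<open>Kernels\<close>

text \<open>The equation is demanded on \<open>PGF\<close> only, since \<open>sem\<close> may take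
  arbitrary values elsewhere. K is determined by F, as \<open>kernel_monom\<close> shows.\<close>

definition is_kernel :: "('v mfps \<Rightarrow> 'v mfps) \<Rightarrow> (('v \<Rightarrow> nat) \<Rightarrow> 'v mfps) \<Rightarrow> bool" where
  "is_kernel F K \<longleftrightarrow> (\<forall>\<sigma>. K \<sigma> \<in> PGF) \<and> (\<forall>g\<in>PGF. F g = mix (coeff g) K)"

lemma kernel_in_PGF: "is_kernel F K \<Longrightarrow> g \<in> PGF \<Longrightarrow> F g \<in> PGF"
  by (auto simp: is_kernel_def PGF_iff_subprob[of g] intro: mix_in_PGF)

lemma kernel_monom: "is_kernel F K \<Longrightarrow> F (monom \<sigma>) = K \<sigma>"
  by (simp add: is_kernel_def monom_in_PGF mix_monom_left)

text \<open>Monotonicity of mixtures in the weights makes F s an upper bound; Fatou, with weights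
  converging to those of s, makes it the least one.\<close>

lemma kernel_continuous:
  assumes F: "is_kernel F K" and PGF: "\<And>n. \<Gamma> n \<in> PGF" and inc: "incseq \<Gamma>"
  shows "\<exists>s. is_sup_PGF (range \<Gamma>) s \<and> is_sup_PGF (F ` range \<Gamma>) (F s)"
proof -
  obtain s where s: "is_sup_PGF (range \<Gamma>) s" "\<And>\<sigma>. (\<lambda>n. coeff (\<Gamma> n) \<sigma>) \<longlonglongrightarrow> coeff s \<sigma>"
    using incseq_PGF_limit[OF PGF inc] by blast
  then have sP: "s \<in> PGF" and le: "\<Gamma> n \<le> s" for n
    by (auto simp: is_sup_PGF_def)
  have K: "K \<sigma> \<in> PGF" and F_eq: "g \<in> PGF \<Longrightarrow> F g = mix (coeff g) K" for \<sigma> g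
    using F by (simp_all add: is_kernel_def)
  have w: "subprob (coeff (\<Gamma> n))" "subprob (coeff s)" for n
    using PGF sP by (simp_all add: PGF_iff_subprob)
  have "F (\<Gamma> n) \<le> F s" for n
    unfolding F_eq[OF PGF] F_eq[OF sP]
    by (rule mix_mono) (use w K le in \<open>simp_all add: less_eq_mfps_def\<close>)
  moreover have "F s \<le> u" if u: "\<And>n. F (\<Gamma> n) \<le> u" for u
  proof -
    have "mix (coeff s) K \<le> u"
      by (rule mix_limit_le[OF w(1) K s(2) tendsto_const u[unfolded F_eq[OF PGF]]])
    then show ?thesis
      by (simp add: F_eq[OF sP])
  qed
  ultimately have "is_sup_PGF (F ` range \<Gamma>) (F s)"
    using kernel_in_PGF[OF F sP] by (auto simp: is_sup_PGF_def)
  with s(1) show ?thesis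
    by blast
qed

lemma kernel_comp:
  assumes "is_kernel F K" "is_kernel G L"
  shows "is_kernel (G \<circ> F) (\<lambda>\<sigma>. G (K \<sigma>))"
proof -
  have K: "K \<sigma> \<in> PGF" and L: "L \<sigma> \<in> PGF" for \<sigma>
    using assms by (auto simp: is_kernel_def)
  have "G (F g) = mix (coeff g) (\<lambda>\<sigma>. G (K \<sigma>))" if g: "g \<in> PGF" for g
  proof -
    have "G (F g) = mix (coeff (mix (coeff g) K)) L"
      using assms g kernel_in_PGF[OF assms(1) g] by (simp add: is_kernel_def)
    also have "\<dots> = mix (coeff g) (\<lambda>\<sigma>. mix (coeff (K \<sigma>)) L)"
      using g K L by (intro mix_mix) (simp_all add: PGF_iff_subprob)
    finally show ?thesis
      using assms(2) K by (simp add: is_kernel_def)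
  qed
  then show ?thesis
    using K kernel_in_PGF[OF assms(2)] by (auto simp: is_kernel_def)
qed

section \<open>Products and substitution\<close>

lemma coeff_monom_times:
  "coeff (monom \<sigma> * h) \<tau> = (if \<sigma> \<le> \<tau> then coeff h (\<tau> - \<sigma>) else 0)"
proof -
  have "coeff (monom \<sigma> * h) \<tau> = (\<Sum>\<alpha> | \<alpha> \<le> \<tau>. if \<alpha> = \<sigma> then coeff h (\<tau> - \<sigma>) else 0)"
    unfolding coeff_times coeff_monom by (intro sum.cong) auto
  then show ?thesis
    by simp
qed

lemma coeff_times_monom:
  "coeff (h * monom \<sigma>) \<tau> = (if \<sigma> \<le> \<tau> then coeff h (\<tau> - \<sigma>) else 0)"
  using coeff_monom_times[of \<sigma> h] by (simp add: mult.commute)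

text \<open>The product distributes over the monomials of the first factor. At exponent \<tau> only
  the finitely many \<sigma> \<le> \<tau> contribute.\<close>

lemma times_eq_mix: "f * h = mix (coeff f) (\<lambda>\<sigma>. monom \<sigma> * h)"
proof (rule mfps_eqI)
  fix \<tau>
  have "((\<lambda>\<sigma>. coeff f \<sigma> * coeff (monom \<sigma> * h) \<tau>) has_sum coeff (f * h) \<tau>) UNIV"
    by (rule has_sum_finite_neutralI[of "{\<alpha>. \<alpha> \<le> \<tau>}"]) (auto simp: coeff_times[of f] coeff_monom_times)
  then show "coeff (f * h) \<tau> = coeff (mix (coeff f) (\<lambda>\<sigma>. monom \<sigma> * h)) \<tau>"
    by (simp add: coeff_mix infsumI)
qed

lemma monom_times_in_PGF:
  assumes h: "h \<in> PGF"
  shows "monom \<sigma> * h \<in> PGF"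
proof -
  have "(coeff h has_sum (\<Sum>\<^sub>\<infinity>\<rho>. coeff h \<rho>)) UNIV"
    using h by (auto simp: PGF_def intro: has_sum_infsum)
  \<comment> \<open>Multiplying by a monomial shifts exponents: adding \<sigma> is a bijection from
    all exponents onto those above \<sigma>, so the total mass is preserved.\<close>
  then have "(coeff (monom \<sigma> * h) has_sum (\<Sum>\<^sub>\<infinity>\<rho>. coeff h \<rho>)) {\<tau>. \<sigma> \<le> \<tau>}"
    by (rule has_sum_reindex_bij_witness[of _ "\<lambda>\<tau>. \<tau> - \<sigma>" "\<lambda>\<rho> x. \<rho> x + \<sigma> x", THEN iffD1, rotated -1])
      (auto simp: coeff_monom_times le_fun_def fun_eq_iff fun_diff_def)
  then have "(coeff (monom \<sigma> * h) has_sum (\<Sum>\<^sub>\<infinity>\<rho>. coeff h \<rho>)) UNIV"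
    by (rule has_sum_cong_neutral[THEN iffD1, rotated -1])
      (auto simp: coeff_monom_times)
  with h show ?thesis
    by (auto simp: PGF_def infsumI has_sum_imp_summable coeff_monom_times)
qed

lemma kernel_times: "h \<in> PGF \<Longrightarrow> is_kernel (\<lambda>g. g * h) (\<lambda>\<sigma>. monom \<sigma> * h)"
  by (auto simp: is_kernel_def monom_times_in_PGF intro: times_eq_mix)

lemma power_in_PGF: "h \<in> PGF \<Longrightarrow> h ^ i \<in> PGF"
  by (induction i) (auto simp: one_mfps_def monom_in_PGF intro: kernel_in_PGF[OF kernel_times])

lemma var_power: "var x ^ i = monom ((\<lambda>_. 0)(x := i))"
proof (induction i)
  case 0
  show ?case
    by (simp add: one_mfps_def fun_upd_idem)
next
  case (Suc i)
  have "coeff (monom ((\<lambda>_. 0)(x := 1)) * monom ((\<lambda>_. 0)(x := i))) \<tau> =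
      coeff (monom ((\<lambda>_. 0)(x := Suc i))) \<tau>" for \<tau> :: "'a \<Rightarrow> nat"
  proof -
    have "(\<lambda>_. 0)(x := 1) \<le> \<tau> \<and> \<tau> - (\<lambda>_. 0)(x := 1) = (\<lambda>_. 0)(x := i) \<longleftrightarrow>
        \<tau> = (\<lambda>_. 0)(x := Suc i)"
      by (auto simp: le_fun_def fun_eq_iff split: if_splits)
    then show ?thesis
      by (auto simp: coeff_monom_times coeff_monom)
  qed
  then have "monom ((\<lambda>_. 0)(x := 1)) * monom ((\<lambda>_. 0)(x := i)) = monom ((\<lambda>_. 0)(x := Suc i))"
    by (rule mfps_eqI)
  then show ?case
    by (simp only: power_Suc Suc) (simp only: var_def)
qed

lemma fps_subst_eq_mix: "fps_subst D h = mix (fps_nth D) (\<lambda>i. h ^ i)"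
  by (simp add: fps_subst_def mix_def)

lemma fps_subst_in_PGF:
  assumes "D \<in> PGF1" "h \<in> PGF"
  shows "fps_subst_summable D h" "fps_subst D h \<in> PGF"
  using assms unfolding fps_subst_summable_def fps_subst_eq_mix
  by (auto simp: PGF1_iff_subprob power_in_PGF intro: mfps_summable_mix mix_in_PGF)

text \<open>Both sides group one nonnegative sum over pairs (i, \<alpha>) with \<alpha> y = 0.
  Summing over \<alpha> first gives the terms of \<open>subst\<close>; identifying the pair with
  \<sigma> = \<alpha>(y := i) gives the mixture.\<close>

lemma has_sum_subst:
  assumes g: "g \<in> PGF" and h: "h \<in> PGF"
  shows "((\<lambda>i. coeff (coeff_in y g i * h ^ i) \<tau>) has_sum
      coeff (mix (coeff g) (\<lambda>\<sigma>. monom (\<sigma>(y := 0)) * h ^ \<sigma> y)) \<tau>) UNIV"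
proof (rule has_sum_SigmaD)
  have bij: "bij_betw (\<lambda>(i, \<alpha>). \<alpha>(y := i)) (UNIV \<times> {\<alpha> :: 'a \<Rightarrow> nat. \<alpha> y = 0}) UNIV"
    by (rule bij_betwI[where g = "\<lambda>\<sigma>. (\<sigma> y, \<sigma>(y := 0))"]) (auto simp: fun_eq_iff)
  have "((\<lambda>\<sigma>. coeff g \<sigma> * coeff (monom (\<sigma>(y := 0)) * h ^ \<sigma> y) \<tau>) has_sum
      coeff (mix (coeff g) (\<lambda>\<sigma>. monom (\<sigma>(y := 0)) * h ^ \<sigma> y)) \<tau>) UNIV"
    using g h by (intro has_sum_mix monom_times_in_PGF power_in_PGF) (auto simp: PGF_iff_subprob)
  then have "((\<lambda>p. coeff g ((snd p)(y := fst p)) * coeff (monom ((snd p)(y := 0)) * h ^ fst p) \<tau>) has_sum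
      coeff (mix (coeff g) (\<lambda>\<sigma>. monom (\<sigma>(y := 0)) * h ^ \<sigma> y)) \<tau>) (UNIV \<times> {\<alpha>. \<alpha> y = 0})"
    by (subst (asm) has_sum_reindex_bij_betw[OF bij, symmetric]) (simp add: case_prod_unfold)
  then show "((\<lambda>(i, \<alpha>). coeff g (\<alpha>(y := i)) * coeff (monom \<alpha> * h ^ i) \<tau>) has_sum
      coeff (mix (coeff g) (\<lambda>\<sigma>. monom (\<sigma>(y := 0)) * h ^ \<sigma> y)) \<tau>) (UNIV \<times> {\<alpha>. \<alpha> y = 0})"
    by (rule has_sum_cong[THEN iffD1, rotated]) (auto simp: fun_upd_idem)
  fix i
  show "((\<lambda>\<alpha>. case (i, \<alpha>) of (i, \<alpha>) \<Rightarrow> coeff g (\<alpha>(y := i)) * coeff (monom \<alpha> * h ^ i) \<tau>) has_sum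
      coeff (coeff_in y g i * h ^ i) \<tau>) {\<alpha>. \<alpha> y = 0}"
    unfolding prod.case
  \<comment> \<open>For fixed i this is a Cauchy product: only \<alpha> \<le> \<tau> contribute, and
    \<open>coeff_in y g i\<close> is supported on \<alpha> y = 0.\<close>
  proof (rule has_sum_finite_neutralI[of "{\<alpha>. \<alpha> \<le> \<tau> \<and> \<alpha> y = 0}"])
    show "finite {\<alpha>. \<alpha> \<le> \<tau> \<and> \<alpha> y = 0}"
      by (rule finite_subset[OF _ finite_exponents_le[of \<tau>]]) auto
    show "coeff (coeff_in y g i * h ^ i) \<tau> =
        (\<Sum>\<alpha> | \<alpha> \<le> \<tau> \<and> \<alpha> y = 0. coeff g (\<alpha>(y := i)) * coeff (monom \<alpha> * h ^ i) \<tau>)"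
      unfolding coeff_times[of "coeff_in y g i"]
      by (rule sum.mono_neutral_cong_right) (auto simp: coeff_in_def coeff_monom_times)
  qed (auto simp: coeff_monom_times)
qed

lemma subst_summable: "g \<in> PGF \<Longrightarrow> h \<in> PGF \<Longrightarrow> subst_summable y h g"
  by (auto simp: subst_summable_def mfps_summable_def
      intro: has_sum_imp_summable[OF has_sum_subst])

lemma kernel_subst:
  assumes "h \<in> PGF"
  shows "is_kernel (subst y h) (\<lambda>\<sigma>. monom (\<sigma>(y := 0)) * h ^ \<sigma> y)"
  using assms has_sum_subst[OF _ assms]
  by (auto simp: is_kernel_def monom_times_in_PGF power_in_PGF subst_def mfps_infsum_def infsumI
      intro!: mfps_eqI)

text \<open>Truncated subtraction in the kernel reflects that decrementing 0 leaves the state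
  unchanged.\<close>

lemma kernel_decr:
  "is_kernel (\<lambda>g. div_var x (g - subst x 0 g) + subst x 0 g) (\<lambda>\<sigma>. monom (\<sigma>(x := \<sigma> x - 1)))"
  unfolding is_kernel_def
proof (intro conjI allI ballI mfps_eqI monom_in_PGF)
  fix g :: "'a mfps" and \<tau>
  \<comment> \<open>The predecessors of \<tau> under the decrement: the state one higher in x and,
    if \<tau> x = 0, also \<tau> itself.\<close>
  let ?S = "insert (\<tau>(x := Suc (\<tau> x))) (if \<tau> x = 0 then {\<tau>} else {})"
  have supp: "\<tau> = \<sigma>(x := \<sigma> x - 1) \<longleftrightarrow> \<sigma> \<in> ?S" for \<sigma>
    by (cases "\<sigma> x") (auto simp: fun_eq_iff, metis)
  have ne: "\<tau> \<noteq> \<tau>(x := Suc (\<tau> x))"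
    by (metis fun_upd_same n_not_Suc_n)
  have "((\<lambda>\<sigma>. coeff g \<sigma> * coeff (monom (\<sigma>(x := \<sigma> x - 1))) \<tau>) has_sum
      coeff g (\<tau>(x := Suc (\<tau> x))) + (if \<tau> x = 0 then coeff g \<tau> else 0)) UNIV"
    unfolding coeff_monom supp using ne
    by (intro has_sum_finite_neutralI[of ?S]) auto
  then show "coeff (div_var x (g - subst x 0 g) + subst x 0 g) \<tau> =
      coeff (mix (coeff g) (\<lambda>\<sigma>. monom (\<sigma>(x := \<sigma> x - 1)))) \<tau>"
    by (auto simp: coeff_mix infsumI subst_0 coeff_in_def div_var_def coeff_add coeff_diff fun_upd_idem)
qed

section \<open>Conditionals and loops\<close>

lemma coeff_sum: "coeff (sum f A) \<sigma> = (\<Sum>i\<in>A. coeff (f i) \<sigma>)"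
  by (induction A rule: infinite_finite_induct) (auto simp: coeff_add)

text \<open>The quotient of factorials is (\<tau> x + 1) ... (\<tau> x + i). At \<tau> x = 0 it is
  i!, which cancels the factor 1 / i! in \<open>less_part\<close>.\<close>

lemma coeff_deriv_var_funpow:
  "coeff ((deriv_var x ^^ i) g) \<tau> = fact (\<tau> x + i) / fact (\<tau> x) * coeff g (\<tau>(x := \<tau> x + i))"
proof (induction i arbitrary: \<tau>)
  case (Suc i)
  have "coeff ((deriv_var x ^^ Suc i) g) \<tau> =
      real (Suc (\<tau> x)) * coeff ((deriv_var x ^^ i) g) (\<tau>(x := Suc (\<tau> x)))"
    by (simp add: deriv_var_def[of _ "(deriv_var x ^^ i) g"])
  also have "\<dots> = real (Suc (\<tau> x)) *
      (fact (\<tau> x + Suc i) / fact (Suc (\<tau> x)) * coeff g (\<tau>(x := \<tau> x + Suc i)))"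
    by (simp only: Suc fun_upd_same fun_upd_upd add_Suc_right add_Suc)
  also have "\<dots> = fact (\<tau> x + Suc i) / fact (\<tau> x) * coeff g (\<tau>(x := \<tau> x + Suc i))"
    by (simp only: fact_Suc[of "\<tau> x"]) simp
  finally show ?case .
qed simp

text \<open>In the i-th summand the factor \<open>var x ^ i\<close> requires i \<le> \<tau> x and
  evaluation at 0 requires \<tau> x - i = 0, so exactly the exponents with \<tau> x = i
  survive.\<close>

lemma coeff_less_part: "coeff (less_part x n g) \<tau> = (if \<tau> x < n then coeff g \<tau> else 0)"
proof -
  have "coeff ((1 / fact i) *\<^sub>R (subst x 0 ((deriv_var x ^^ i) g) * var x ^ i)) \<tau> =
      (if \<tau> x = i then coeff g \<tau> else 0)" for i
  proof -
    have "(\<lambda>_. 0)(x := i) \<le> \<tau> \<longleftrightarrow> i \<le> \<tau> x"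
      by (auto simp: le_fun_def)
    moreover have "(\<tau> - (\<lambda>_. 0)(x := i))(x := j) = \<tau>(x := j)" for j
      by (auto simp: fun_eq_iff)
    ultimately show ?thesis
      by (auto simp: coeff_scaleR var_power coeff_times_monom
          subst_0 coeff_in_def coeff_deriv_var_funpow)
  qed
  then show ?thesis
    by (simp add: less_part_def coeff_sum)
qed

lemma less_part_in_PGF:
  assumes "g \<in> PGF"
  shows "less_part x n g \<in> PGF" "g - less_part x n g \<in> PGF"
  using assms by (auto simp: less_eq_mfps_def coeff_less_part coeff_diff coeff_nonneg
      intro!: PGF_dominated[OF assms])

lemma kernel_if:
  assumes F: "is_kernel F K" and G: "is_kernel G L"
  shows "is_kernel (\<lambda>g. F (less_part x n g) + G (g - less_part x n g))
    (\<lambda>\<sigma>. if \<sigma> x < n then K \<sigma> else L \<sigma>)"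
  unfolding is_kernel_def
proof (intro conjI allI ballI mfps_eqI)
  show "(if \<sigma> x < n then K \<sigma> else L \<sigma>) \<in> PGF" for \<sigma>
    using F G by (simp add: is_kernel_def)
  fix g :: "'a mfps" and \<tau>
  assume "g \<in> PGF"
  note g = less_part_in_PGF[OF this, of x n]
  have eqs: "F (less_part x n g) = mix (coeff (less_part x n g)) K"
    "G (g - less_part x n g) = mix (coeff (g - less_part x n g)) L"
    using F G g by (simp_all add: is_kernel_def)
  have "((\<lambda>\<sigma>. coeff (less_part x n g) \<sigma> * coeff (K \<sigma>) \<tau> +
        coeff (g - less_part x n g) \<sigma> * coeff (L \<sigma>) \<tau>) has_sum
      coeff (F (less_part x n g) + G (g - less_part x n g)) \<tau>) UNIV"
    unfolding eqs coeff_add using F G g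
    by (intro has_sum_add has_sum_mix) (auto simp: is_kernel_def PGF_iff_subprob[symmetric])
  \<comment> \<open>The guard sends each \<sigma> wholly to one branch, so one of the two terms
    vanishes.\<close>
  moreover have "coeff (less_part x n g) \<sigma> * coeff (K \<sigma>) \<tau> +
      coeff (g - less_part x n g) \<sigma> * coeff (L \<sigma>) \<tau> =
      coeff g \<sigma> * coeff (if \<sigma> x < n then K \<sigma> else L \<sigma>) \<tau>" for \<sigma>
    by (simp add: coeff_diff coeff_less_part)
  ultimately show "coeff (F (less_part x n g) + G (g - less_part x n g)) \<tau> =
      coeff (mix (coeff g) (\<lambda>\<sigma>. if \<sigma> x < n then K \<sigma> else L \<sigma>)) \<tau>"
    by (simp add: coeff_mix infsumI)
qed

section \<open>Kleene iteration for loops\<close>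

lemma kernel_id: "is_kernel (\<lambda>g. g) monom"
  by (simp add: is_kernel_def monom_in_PGF)

lemma kernel_mix: "(\<And>\<sigma>. K \<sigma> \<in> PGF) \<Longrightarrow> is_kernel (\<lambda>g. mix (coeff g) K) K"
  by (simp add: is_kernel_def)

text \<open>One unfolding of a loop is a conditional whose else branch is the identity.\<close>

lemma kernel_while_op:
  assumes "is_kernel F K" "is_kernel \<psi> L"
  shows "is_kernel (while_op x n F \<psi>) (\<lambda>\<sigma>. if \<sigma> x < n then \<psi> (K \<sigma>) else monom \<sigma>)"
  using kernel_if[OF kernel_comp[OF assms] kernel_id, of x n]
  by (simp add: while_op_def add.commute)

text \<open>The Kleene iterates, kept as kernels rather than as transformers. Iterate m collects the
  runs that leave the loop after fewer than m executions of the body.\<close>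

primrec while_approx ::
    "'v \<Rightarrow> nat \<Rightarrow> (('v \<Rightarrow> nat) \<Rightarrow> 'v mfps) \<Rightarrow> nat \<Rightarrow> ('v \<Rightarrow> nat) \<Rightarrow> 'v mfps" where
  "while_approx x n K 0 = (\<lambda>\<sigma>. 0)"
| "while_approx x n K (Suc m) =
     (\<lambda>\<sigma>. if \<sigma> x < n then mix (coeff (K \<sigma>)) (while_approx x n K m) else monom \<sigma>)"

lemma while_approx_in_PGF:
  assumes "\<And>\<sigma>. K \<sigma> \<in> PGF"
  shows "while_approx x n K m \<sigma> \<in> PGF"
  using assms
  by (induction m arbitrary: \<sigma>) (auto simp: zero_in_PGF monom_in_PGF PGF_iff_subprob[of "K _"] intro: mix_in_PGF)

lemma while_approx_Suc_ge:
  assumes K: "\<And>\<sigma>. K \<sigma> \<in> PGF"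
  shows "while_approx x n K m \<sigma> \<le> while_approx x n K (Suc m) \<sigma>"
proof (induction m arbitrary: \<sigma>)
  case 0
  show ?case
    using while_approx_in_PGF[of K x n "Suc 0" \<sigma>, OF K]
    by (simp add: less_eq_mfps_def coeff_nonneg)
next
  case (Suc m)
  have "mix (coeff (K \<sigma>)) (while_approx x n K m) \<le> mix (coeff (K \<sigma>)) (while_approx x n K (Suc m))"
    using K Suc by (intro mix_mono while_approx_in_PGF) (auto simp: PGF_iff_subprob)
  then show ?case
    by (subst (1 2) while_approx.simps) simp
qed

text \<open>The pointwise limit L of the iterates is a kernel solving the loop equation, and any
  fixed point dominates every iterate, hence by Fatou also the limit.\<close>

lemma while_least_fixpoint:
  fixes F :: "'v::finite mfps \<Rightarrow> 'v mfps"
  assumes F: "is_kernel F K"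
  obtains L \<psi> where "is_least_fixpoint (while_op x n F) \<psi>" "is_kernel \<psi> L"
proof -
  have K: "K \<sigma> \<in> PGF" for \<sigma>
    using F by (simp add: is_kernel_def)
  let ?A = "while_approx x n K"
  have A: "?A m \<sigma> \<in> PGF" for m \<sigma>
    by (rule while_approx_in_PGF[OF K])
  have A_Suc: "?A m \<sigma> \<le> ?A (Suc m) \<sigma>" for m \<sigma>
    by (rule while_approx_Suc_ge[OF K])
  have inc: "incseq (\<lambda>m. ?A m \<sigma>)" for \<sigma>
    by (rule incseq_SucI) (rule A_Suc)
  have "\<exists>s. is_sup_PGF (range (\<lambda>m. ?A m \<sigma>)) s \<and> (\<forall>\<tau>. (\<lambda>m. coeff (?A m \<sigma>) \<tau>) \<longlonglongrightarrow> coeff s \<tau>)" for \<sigma>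
    using incseq_PGF_limit[of "\<lambda>m. ?A m \<sigma>", OF A inc] by metis
  then obtain L where "\<And>\<sigma>. is_sup_PGF (range (\<lambda>m. ?A m \<sigma>)) (L \<sigma>)"
      and lim: "\<And>\<sigma> \<tau>. (\<lambda>m. coeff (?A m \<sigma>) \<tau>) \<longlonglongrightarrow> coeff (L \<sigma>) \<tau>"
    by metis
  then have L: "L \<sigma> \<in> PGF" and A_le: "?A m \<sigma> \<le> L \<sigma>"
      and L_least: "\<And>u. u \<in> PGF \<Longrightarrow> (\<And>m. ?A m \<sigma> \<le> u) \<Longrightarrow> L \<sigma> \<le> u" for \<sigma> m
    by (auto simp: is_sup_PGF_def)
  have w: "subprob (coeff f)" if "f \<in> PGF" for f :: "'v mfps"
    using that by (simp add: PGF_iff_subprob)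
  have unfold: "(if \<sigma> x < n then mix (coeff (K \<sigma>)) L else monom \<sigma>) = L \<sigma>" (is "?R = _") for \<sigma>
  proof (rule order_antisym)
    \<comment> \<open>Iterate m mixed through K \<sigma> is iterate m + 1, which lies below L
      \<sigma>; Fatou passes this bound to the limit.\<close>
    have "mix (coeff (K \<sigma>)) L \<le> L \<sigma>" if "\<sigma> x < n"
    proof (rule mix_limit_le[OF w[OF K] A tendsto_const lim])
      show "mix (coeff (K \<sigma>)) (?A m) \<le> L \<sigma>" for m
        using A_le[where m = "Suc m" and \<sigma> = \<sigma>] that by simp
    qed
    moreover have "monom \<sigma> \<le> L \<sigma>" if "\<not> \<sigma> x < n"
      using A_le[where m = "Suc 0" and \<sigma> = \<sigma>] that by simp
    ultimately show "?R \<le> L \<sigma>"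
      by simp
    have R: "?R \<in> PGF"
      using mix_in_PGF[OF w[OF K] L] by (simp add: monom_in_PGF)
    have "?A m \<sigma> \<le> ?R" for m
    proof -
      have "mix (coeff (K \<sigma>)) (?A m) \<le> mix (coeff (K \<sigma>)) L"
        using w[OF K] A L A_le by (intro mix_mono) auto
      then have "?A (Suc m) \<sigma> \<le> ?R"
        by simp
      with A_Suc show ?thesis
        by (rule order_trans)
    qed
    with R show "L \<sigma> \<le> ?R"
      by (rule L_least)
  qed
  \<comment> \<open>The restriction makes \<psi> extensional, as \<open>is_least_fixpoint\<close>
    requires.\<close>
  define \<psi> where "\<psi> = restrict (\<lambda>g. mix (coeff g) L) PGF"
  have \<psi>: "is_kernel \<psi> L"
    using L by (simp add: is_kernel_def \<psi>_def)
  have "is_least_fixpoint (while_op x n F) \<psi>"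
    unfolding is_least_fixpoint_def
  proof (intro conjI ballI impI)
    show "\<psi> \<in> PGF \<rightarrow>\<^sub>E PGF"
      using kernel_in_PGF[OF \<psi>] by (auto simp: \<psi>_def)
    have "(\<lambda>\<sigma>. if \<sigma> x < n then \<psi> (K \<sigma>) else monom \<sigma>) = L"
      by (simp only: \<psi>_def restrict_apply K if_True unfold)
    then show "while_op x n F \<psi> f = \<psi> f" if "f \<in> PGF" for f
      using kernel_while_op[OF F \<psi>, of x n] \<psi> that by (simp add: is_kernel_def)
  next
    fix \<chi> and f :: "'v mfps"
    assume \<chi>: "\<chi> \<in> PGF \<rightarrow>\<^sub>E PGF" and fixpoint: "\<forall>f\<in>PGF. while_op x n F \<chi> f = \<chi> f" and f: "f \<in> PGF"
    \<comment> \<open>The competitor \<chi> is an arbitrary map, with neither monotonicity nor a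
      kernel available. The induction therefore ranges over all g and uses \<chi> only at the single
      argument \<open>F (less_part x n g)\<close>.\<close>
    have le: "mix (coeff g) (?A m) \<le> \<chi> g" if "g \<in> PGF" for m g
      using that
    proof (induction m arbitrary: g)
      case 0
      have "\<chi> g \<in> PGF"
        using \<chi> 0 by auto
      then show ?case
        by (simp add: less_eq_mfps_def coeff_mix coeff_nonneg)
    next
      case (Suc m)
      have "mix (coeff g) (?A (Suc m)) = while_op x n F (\<lambda>g. mix (coeff g) (?A m)) g"
        using kernel_while_op[OF F kernel_mix[of "?A m"], of x n] A Suc.prems
        by (simp add: is_kernel_def)
      also have "\<dots> \<le> while_op x n F \<chi> g"
        using Suc.IH[OF kernel_in_PGF[OF F less_part_in_PGF(1)[OF Suc.prems, of x n]]]
        by (simp add: while_op_def less_eq_mfps_def coeff_add)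
      finally show ?case
        using fixpoint Suc.prems by simp
    qed
    have "mix (coeff f) L \<le> \<chi> f"
      by (rule mix_limit_le[OF w[OF f] A tendsto_const lim le[OF f]])
    then show "\<psi> f \<le> \<chi> f"
      using f by (simp add: \<psi>_def)
  qed
  with \<psi> that show ?thesis
    by blast
qed

text \<open>Minimality gives agreement on \<open>PGF\<close>; extensionality fixes the values
  elsewhere, so the \<open>THE\<close> in \<open>sem\<close> has a unique candidate.\<close>

lemma is_least_fixpoint_unique:
  assumes "is_least_fixpoint \<Phi> \<psi>" "is_least_fixpoint \<Phi> \<chi>"
  shows "\<psi> = \<chi>"
proof (rule PiE_ext)
  show "\<psi> \<in> PGF \<rightarrow>\<^sub>E PGF" "\<chi> \<in> PGF \<rightarrow>\<^sub>E PGF"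
    using assms by (auto simp: is_least_fixpoint_def)
  show "\<psi> f = \<chi> f" if "f \<in> PGF" for f
    using assms that by (intro order_antisym) (auto simp: is_least_fixpoint_def)
qed

section \<open>Induction over programs and the theorem\<close>

text \<open>Definedness and the kernel property go together: a sequence needs its first program to
  return a PGF before the second is defined there, and a loop needs a kernel for its body to obtain
  its least fixed point.\<close>

lemma sem_kernel:
  fixes \<D> :: "'d \<Rightarrow> real fps" and P :: "('v::finite, 'd) redip"
  assumes \<D>: "\<And>D. \<D> D \<in> PGF1"
  shows "(\<forall>g\<in>PGF. sem_defined \<D> P g) \<and> (\<exists>K. is_kernel (sem \<D> P) K)"
proof (induction P)
  case (Assign x n)
  have "1 \<in> (PGF :: 'v mfps set)"
    by (simp add: one_mfps_def monom_in_PGF)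
  moreover have "var x ^ n \<in> PGF"
    by (simp add: var_power monom_in_PGF)
  ultimately show ?case
    using kernel_comp[OF kernel_subst kernel_times] by (auto simp: comp_def subst_summable)
next
  case (Decr x)
  show ?case
    using kernel_decr by (auto simp: subst_summable_0)
next
  case (AddIid x D y)
  have var: "var z \<in> PGF" for z :: 'v
    by (simp add: var_def monom_in_PGF)
  note D = fps_subst_in_PGF[OF \<D> var]
  have h: "var y * fps_subst (\<D> D) (var x) \<in> PGF"
    using var D kernel_in_PGF[OF kernel_times] by blast
  show ?case
    using D kernel_subst[OF h, of y] subst_summable[OF _ h] by auto
next
  case (IfLess x n P\<^sub>1 P\<^sub>2)
  then obtain K L where "is_kernel (sem \<D> P\<^sub>1) K" "is_kernel (sem \<D> P\<^sub>2) L"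
    by blast
  with IfLess show ?case
    using kernel_if[of "sem \<D> P\<^sub>1" K "sem \<D> P\<^sub>2" L x n] by (auto simp: less_part_in_PGF)
next
  case (Seq P\<^sub>1 P\<^sub>2)
  then obtain K L where "is_kernel (sem \<D> P\<^sub>1) K" "is_kernel (sem \<D> P\<^sub>2) L"
    by blast
  with Seq show ?case
    using kernel_comp[of "sem \<D> P\<^sub>1" K "sem \<D> P\<^sub>2" L, unfolded comp_def] kernel_in_PGF[of "sem \<D> P\<^sub>1" K]
    by (auto simp: comp_def)
next
  case (WhileLess x n P\<^sub>1)
  then obtain K where "is_kernel (sem \<D> P\<^sub>1) K"
    by blast
  then obtain L \<psi> where \<psi>: "is_least_fixpoint (while_op x n (sem \<D> P\<^sub>1)) \<psi>" "is_kernel \<psi> L"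
    by (rule while_least_fixpoint)
  then have ex1: "\<exists>!\<psi>. is_least_fixpoint (while_op x n (sem \<D> P\<^sub>1)) \<psi>"
    using is_least_fixpoint_unique by blast
  then have "sem \<D> (WhileLess x n P\<^sub>1) = \<psi>"
    using \<psi>(1) by (simp add: the1_equality)
  with WhileLess ex1 \<psi>(2) show ?case
    by (auto simp: less_part_in_PGF)
qed

theorem theorem2:
  fixes \<D> :: "'d \<Rightarrow> real fps" and P :: "('v::finite, 'd) redip"
  assumes "\<And>D. \<D> D \<in> PGF1"
  shows
    "(\<forall>g\<in>PGF. sem_defined \<D> P g \<and> sem \<D> P g \<in> PGF) \<and>
     (\<forall>\<Gamma> :: nat \<Rightarrow> 'v mfps. range \<Gamma> \<subseteq> PGF \<and> incseq \<Gamma> \<longrightarrow>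
        (\<exists>s. is_sup_PGF (range \<Gamma>) s \<and> is_sup_PGF (sem \<D> P ` range \<Gamma>) (sem \<D> P s))) \<and>
     (\<forall>g\<in>PGF.
        mfps_summable (\<lambda>\<sigma>. coeff g \<sigma> *\<^sub>R monom \<sigma>) \<and>
        mfps_summable (\<lambda>\<sigma>. coeff g \<sigma> *\<^sub>R sem \<D> P (monom \<sigma>)) \<and>
        sem \<D> P (mfps_infsum (\<lambda>\<sigma>. coeff g \<sigma> *\<^sub>R monom \<sigma>)) =
          mfps_infsum (\<lambda>\<sigma>. coeff g \<sigma> *\<^sub>R sem \<D> P (monom \<sigma>)))"
proof -
  obtain K where K: "is_kernel (sem \<D> P) K" and defd: "\<forall>g\<in>PGF. sem_defined \<D> P g"
    using sem_kernel[of \<D> P, OF assms] by blast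
  show ?thesis
  proof (intro conjI ballI allI impI)
    fix g :: "'v mfps"
    assume g: "g \<in> PGF"
    then show "sem_defined \<D> P g" "sem \<D> P g \<in> PGF"
      using defd kernel_in_PGF[OF K] by auto
    \<comment> \<open>Since K \<sigma> is the value at \<open>monom \<sigma>\<close>, both series
      are mixtures with weights \<open>coeff g\<close>, hence summable.\<close>
    have "subprob (coeff g)" "\<And>\<sigma>. K \<sigma> \<in> PGF"
      using g K by (auto simp: PGF_iff_subprob[symmetric] is_kernel_def)
    then show "mfps_summable (\<lambda>\<sigma>. coeff g \<sigma> *\<^sub>R monom \<sigma>)"
      "mfps_summable (\<lambda>\<sigma>. coeff g \<sigma> *\<^sub>R sem \<D> P (monom \<sigma>))"
      by (simp_all add: kernel_monom[OF K] mfps_summable_mix monom_in_PGF)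
    \<comment> \<open>The left argument is \<open>mix (coeff g) monom\<close>, which is g, so
      linearity is the defining equation of the kernel at g.\<close>
    show "sem \<D> P (mfps_infsum (\<lambda>\<sigma>. coeff g \<sigma> *\<^sub>R monom \<sigma>)) =
        mfps_infsum (\<lambda>\<sigma>. coeff g \<sigma> *\<^sub>R sem \<D> P (monom \<sigma>))"
      using K g by (simp add: mix_def[symmetric] kernel_monom[OF K] is_kernel_def)
  next
    fix \<Gamma> :: "nat \<Rightarrow> 'v mfps"
    assume "range \<Gamma> \<subseteq> PGF \<and> incseq \<Gamma>"
    then show "\<exists>s. is_sup_PGF (range \<Gamma>) s \<and> is_sup_PGF (sem \<D> P ` range \<Gamma>) (sem \<D> P s)"
      by (intro kernel_continuous[OF K]) auto
  qed
qed

end
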